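(* (a) Let $E$ be $\mathbb{R}^m$ endowed with an absolute norm and let $X_1,\ldots,X_m$ be nonzero Banach spaces. Then $$n\bigl([X_1\oplus\cdots\oplus X_m]_E\bigr)\leq \min\{n(X_1),\ldots,n(X_m)\}.$$ (b) Let $E$ be a Banach space with a normalized one-unconditional (infinite) basis, viewed as a linear subspace of $\mathbb{R}^{\mathbb{N}}$ via the basis, and let $\{X_j: j\in\mathbb{N}\}$ be a sequence of nonzero Banach spaces. Then $$n\Bigl(\Bigl[\bigoplus_{j\in\mathbb{N}}X_j\Bigr]_E\Bigr)\leq \inf\{n(X_j): j\in\mathbb{N}\}.$$
   Context: For a Banach space $X$ (real or complex), $S_X$ and $X^*$ denote its unit sphere and dual, and $L(X)$ the bounded linear operators on $X$. Put $\Pi(X)=\{(x,x^* )\in S_X\times S_{X^*}: x^*(x)=1\}$. The numerical radius of $T\in L(X)$ is $v(T)=\sup\{|x^*(Tx)|:(x,x^* )\in\Pi(X)\}$, and the numerical index of $X$ is $n(X)=\inf\{v(T): T\in L(X),\ \|T\|=1\}$. An absolute norm on a linear subspace $E$ of $\mathbb{R}^\Lambda$ is a complete norm $\|\cdot\|_E$ such that: (a) if $(a_\lambda),(b_\lambda)\in\mathbb{R}^\Lambda$ satisfy $|a_\lambda|=|b_\lambda|$ for all $\lambda$ and $(a_\lambda)\in E$, then $(b_\lambda)\in E$ and $\|(a_\lambda)\|_E=\|(b_\lambda)\|_E$; (b) for every $\lambda\in\Lambda$, the characteristic function $\chi_{\{\lambda\}}$ belongs to $E$ and has norm $1$. A real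 Banach space with a normalized one-unconditional basis is identified, via the coefficients with respect to the basis, with a linear subspace of $\mathbb{R}^{\mathbb{N}}$ with an absolute norm. For a family $\{X_\lambda:\lambda\in\Lambda\}$ of Banach spaces over the same scalar field ($\mathbb{R}$ or $\mathbb{C}$), the $E$-sum is $\bigl[\bigoplus_{\lambda}X_\lambda\bigr]_E=\{(x_\lambda): x_\lambda\in X_\lambda\ \forall\lambda,\ (\|x_\lambda\|)\in E\}$ with norm $\|(x_\lambda)\|=\|(\|x_\lambda\|)\|_E$; for $\Lambda=\{1,\ldots,m\}$ it is written $[X_1\oplus\cdots\oplus X_m]_E$. *)

theory Defs
  imports "HOL-Algebra.Module" "HOL-Analysis.Euclidean_Space"
    "HOL-Library.Extended_Nonnegative_Real"
begin

text \<open>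
  The theorem is about families of arbitrary Banach spaces, so these are structures with an
  explicit carrier: modules in the sense of \<^theory>\<open>HOL-Algebra.Module\<close> over the field
  \<open>'k\<close> of scalars, together with a norm.  The multiplication and the unit that the module record
  inherits from rings matter only for \<open>scalar_space\<close> below.  Families \<open>'i \<Rightarrow> ('k, 'a) normed_module\<close> use one type \<open>'a\<close> for
  the elements of all members, but the carriers and all operations vary freely with the index; any
  set-indexed family is of this form once its members are placed in the disjoint union of their
  carriers.

  The scalar types of interest are \<^typ>\<open>real\<close> and \<^typ>\<open>complex\<close>.  They are instances of both
  \<^class>\<open>real_normed_field\<close> and \<^class>\<open>euclidean_space\<close>, and up to isometric isomorphism the only
  ones.
\<close>

record ('k, 'a) normed_module = "('k, 'a) module" +
  vnorm :: "'a \<Rightarrow> real"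

text \<open>The scalars, both as the ring over which modules are formed and as a normed space.\<close>

definition scalar_space :: "('k::real_normed_field, 'k) normed_module" where
  "scalar_space =
     \<lparr>carrier = UNIV, monoid.mult = (*), one = 1, ring.zero = 0, add = (+), smult = (*), vnorm = norm\<rparr>"

locale normed_space = Module.module "scalar_space :: ('k, 'k) normed_module" X
  for X :: "('k::real_normed_field, 'a) normed_module" (structure) +
  assumes vnorm_nonneg: "x \<in> carrier X \<Longrightarrow> 0 \<le> vnorm X x"
    and vnorm_eq_zero: "x \<in> carrier X \<Longrightarrow> vnorm X x = 0 \<longleftrightarrow> x = \<zero>"
    and vnorm_smult: "x \<in> carrier X \<Longrightarrow> vnorm X (c \<odot> x) = norm c * vnorm X x"
    and vnorm_triangle:
      "\<lbrakk>x \<in> carrier X; y \<in> carrier X\<rbrakk> \<Longrightarrow> vnorm X (x \<oplus> y) \<le> vnorm X x + vnorm X y"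

locale banach_space = normed_space +
  assumes Cauchy_convergent:
    "\<lbrakk>\<And>n. s n \<in> carrier X;
      \<And>\<epsilon>. 0 < \<epsilon> \<Longrightarrow> \<exists>M. \<forall>m\<ge>M. \<forall>n\<ge>M. vnorm X (s m \<ominus> s n) < \<epsilon>\<rbrakk>
     \<Longrightarrow> \<exists>x \<in> carrier X. (\<lambda>n. vnorm X (s n \<ominus> x)) \<longlonglongrightarrow> 0"

text \<open>
  Operators are represented by functions on the whole element type; only their values on the
  carrier matter below.
\<close>

definition bounded_operators ::
  "('k::real_normed_field, 'a) normed_module \<Rightarrow> ('k, 'b) normed_module \<Rightarrow> ('a \<Rightarrow> 'b) set" where
  "bounded_operators X Y =
     {T \<in> carrier X \<rightarrow> carrier Y.
        (\<forall>x\<in>carrier X. \<forall>y\<in>carrier X. T (x \<oplus>\<^bsub>X\<^esub> y) = T x \<oplus>\<^bsub>Y\<^esub> T y) \<and>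
        (\<forall>c. \<forall>x\<in>carrier X. T (c \<odot>\<^bsub>X\<^esub> x) = c \<odot>\<^bsub>Y\<^esub> T x) \<and>
        (\<exists>K. \<forall>x\<in>carrier X. vnorm Y (T x) \<le> K * vnorm X x)}"

definition operator_norm ::
  "('k::real_normed_field, 'a) normed_module \<Rightarrow> ('k, 'b) normed_module \<Rightarrow> ('a \<Rightarrow> 'b) \<Rightarrow> real" where
  "operator_norm X Y T = (SUP x \<in> {x \<in> carrier X. vnorm X x \<le> 1}. vnorm Y (T x))"

abbreviation dual :: "('k::real_normed_field, 'a) normed_module \<Rightarrow> ('a \<Rightarrow> 'k) set" where
  "dual X \<equiv> bounded_operators X scalar_space"

abbreviation dual_norm :: "('k::real_normed_field, 'a) normed_module \<Rightarrow> ('a \<Rightarrow> 'k) \<Rightarrow> real" where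
  "dual_norm X \<equiv> operator_norm X scalar_space"

definition norming_pairs ::
  "('k::real_normed_field, 'a) normed_module \<Rightarrow> ('a \<times> ('a \<Rightarrow> 'k)) set" where
  "norming_pairs X =
     {(x, f). x \<in> carrier X \<and> vnorm X x = 1 \<and> f \<in> dual X \<and> dual_norm X f = 1 \<and> f x = 1}"

text \<open>
  The supremum and the infimum are taken in \<open>[0, \<infinity>]\<close>.  On nonzero Banach spaces the values are
  finite: \<open>numerical_radius X T \<le> operator_norm X X T\<close>, and \<open>numerical_index X \<le> 1\<close> because
  the identity is an operator of norm one.
\<close>

definition numerical_radius ::
  "('k::real_normed_field, 'a) normed_module \<Rightarrow> ('a \<Rightarrow> 'a) \<Rightarrow> ennreal" where
  "numerical_radius X T = (SUP (x, f) \<in> norming_pairs X. ennreal (norm (f (T x))))"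

definition numerical_index :: "('k::real_normed_field, 'a) normed_module \<Rightarrow> ennreal" where
  "numerical_index X =
     (INF T \<in> {T \<in> bounded_operators X X. operator_norm X X T = 1}. numerical_radius X T)"


definition function_space ::
  "('i \<Rightarrow> real) set \<Rightarrow> (('i \<Rightarrow> real) \<Rightarrow> real) \<Rightarrow> (real, 'i \<Rightarrow> real) normed_module" where
  "function_space E N =
     \<lparr>carrier = E, monoid.mult = (\<lambda>a b i. a i * b i), one = (\<lambda>i. 1), ring.zero = (\<lambda>i. 0),
      add = (\<lambda>a b i. a i + b i), smult = (\<lambda>c a i. c * a i), vnorm = N\<rparr>"

text \<open>
  The first conjunct says that \<open>E\<close> is a linear subspace of the space of all real functions on the
  index type and that \<open>N\<close> is a complete norm on \<open>E\<close>.
\<close>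

definition absolute_norm :: "('i \<Rightarrow> real) set \<Rightarrow> (('i \<Rightarrow> real) \<Rightarrow> real) \<Rightarrow> bool" where
  "absolute_norm E N \<longleftrightarrow>
     banach_space (function_space E N) \<and>
     (\<forall>a b. (\<forall>i. \<bar>a i\<bar> = \<bar>b i\<bar>) \<and> a \<in> E \<longrightarrow> b \<in> E \<and> N a = N b) \<and>
     (\<forall>i. indicator {i} \<in> E \<and> N (indicator {i}) = 1)"

definition E_sum ::
  "('i \<Rightarrow> real) set \<Rightarrow> (('i \<Rightarrow> real) \<Rightarrow> real) \<Rightarrow> ('i \<Rightarrow> ('k::real_normed_field, 'a) normed_module)
     \<Rightarrow> ('k, 'i \<Rightarrow> 'a) normed_module" where
  "E_sum E N X =
     \<lparr>carrier = {x. (\<forall>i. x i \<in> carrier (X i)) \<and> (\<lambda>i. vnorm (X i) (x i)) \<in> E},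
      monoid.mult = (\<lambda>x y i. x i \<otimes>\<^bsub>X i\<^esub> y i), one = (\<lambda>i. \<one>\<^bsub>X i\<^esub>), ring.zero = (\<lambda>i. \<zero>\<^bsub>X i\<^esub>),
      add = (\<lambda>x y i. x i \<oplus>\<^bsub>X i\<^esub> y i), smult = (\<lambda>c x i. c \<odot>\<^bsub>X i\<^esub> x i),
      vnorm = (\<lambda>x. N (\<lambda>i. vnorm (X i) (x i)))\<rparr>"


definition schauder_basis :: "(nat \<Rightarrow> 'e::banach) \<Rightarrow> bool" where
  "schauder_basis e \<longleftrightarrow> (\<forall>x. \<exists>!a :: nat \<Rightarrow> real. (\<lambda>n. a n *\<^sub>R e n) sums x)"

text \<open>
  A basis is unconditional iff every change of signs in the coefficients of a convergent
  expansion gives a convergent expansion; its unconditional constant is one iff the resulting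
  sign-change operators are isometries.
\<close>

definition one_unconditional_basis :: "(nat \<Rightarrow> 'e::banach) \<Rightarrow> bool" where
  "one_unconditional_basis e \<longleftrightarrow>
     schauder_basis e \<and>
     (\<forall>a \<theta> :: nat \<Rightarrow> real. summable (\<lambda>n. a n *\<^sub>R e n) \<and> (\<forall>n. \<theta> n \<in> {-1, 1}) \<longrightarrow>
        summable (\<lambda>n. (\<theta> n * a n) *\<^sub>R e n) \<and>
        norm (\<Sum>n. (\<theta> n * a n) *\<^sub>R e n) = norm (\<Sum>n. a n *\<^sub>R e n))"

text \<open>The Banach space spanned by a basis, viewed as a space of coefficient sequences.\<close>

definition coefficients :: "(nat \<Rightarrow> 'e::banach) \<Rightarrow> (nat \<Rightarrow> real) set" where
  "coefficients e = {a. summable (\<lambda>n. a n *\<^sub>R e n)}"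

definition coefficient_norm :: "(nat \<Rightarrow> 'e::banach) \<Rightarrow> (nat \<Rightarrow> real) \<Rightarrow> real" where
  "coefficient_norm e a = norm (\<Sum>n. a n *\<^sub>R e n)"

end

theory Submission
  imports Defs
begin

text \<open>
  Fix an index \<open>l\<close>.  An operator \<open>T\<close> on the summand \<open>X l\<close> lifts to the operator
  \<open>S x = embed l (T (x l))\<close> on the whole sum, and \<open>S\<close> has the same norm as \<open>T\<close>.  The point is
  that its numerical radius does not exceed that of \<open>T\<close>, so that every competitor in the infimum
  for \<open>X l\<close> is matched by one for the sum.

  Let \<open>(x, f)\<close> be a norming pair of the sum and let \<open>f\<^sub>l\<close> be the restriction of \<open>f\<close> to the summand.
  Replacing the coordinate \<open>x l\<close> by any vector of at most the same norm does not increase the norm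
  of \<open>x\<close>, because an absolute norm is monotone.  Since \<open>f\<close> attains its norm at \<open>x\<close>, the restriction
  \<open>f\<^sub>l\<close> must attain its norm in the direction of \<open>x l\<close>
  (\<open>norming_functional_attains_on_coordinate\<close>).  Thus, unless \<open>f\<^sub>l\<close> or \<open>x l\<close> vanishes, normalizing
  both gives a norming pair \<open>(u, g)\<close> of \<open>X l\<close>, and
  \<open>\<bar>f (S x)\<bar> = \<bar>f\<^sub>l (x l)\<bar> \<bar>g (T u)\<bar> \<le> \<bar>g (T u)\<bar>\<close> (\<open>norming_pair_of_summand\<close>).

  What the argument uses of \<open>E\<close> is that its norm is invariant under changes of sign and normalized
  at the unit vectors (\<open>absolute_function_norm\<close>).  Both the absolute norms and the coefficient
  norms of normalized one-unconditional bases are of this kind, so the two parts of the theorem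
  are instances of \<open>numerical_index_E_sum_le\<close>.
\<close>

section \<open>Operators between normed spaces\<close>

lemma scalar_space_simps [simp]:
  "carrier scalar_space = UNIV" "vnorm scalar_space = norm"
  "\<zero>\<^bsub>scalar_space\<^esub> = 0" "\<one>\<^bsub>scalar_space\<^esub> = 1"
  "a \<oplus>\<^bsub>scalar_space\<^esub> b = a + b" "c \<odot>\<^bsub>scalar_space\<^esub> a = c * a" "c \<otimes>\<^bsub>scalar_space\<^esub> a = c * a"
  by (simp_all add: scalar_space_def)

unbundle inner_syntax

context normed_space
begin

lemma smult_closed' [simp, intro]: "x \<in> carrier X \<Longrightarrow> c \<odot> x \<in> carrier X"
  by (rule smult_closed) auto

lemma smult_zero [simp]: "x \<in> carrier X \<Longrightarrow> 0 \<odot> x = \<zero>"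
  using smult_l_null[of x] by simp

lemma smult_right_zero [simp]: "c \<odot> \<zero> = \<zero>"
  using smult_r_null[of c] by simp

lemma vnorm_zero [simp]: "vnorm X \<zero> = 0"
  using vnorm_eq_zero[of \<zero>] by simp

end

lemma bounded_operatorsD:
  assumes "T \<in> bounded_operators X Y"
  shows "x \<in> carrier X \<Longrightarrow> T x \<in> carrier Y"
    and "x \<in> carrier X \<Longrightarrow> y \<in> carrier X \<Longrightarrow> T (x \<oplus>\<^bsub>X\<^esub> y) = T x \<oplus>\<^bsub>Y\<^esub> T y"
    and "x \<in> carrier X \<Longrightarrow> T (c \<odot>\<^bsub>X\<^esub> x) = c \<odot>\<^bsub>Y\<^esub> T x"
  using assms by (auto simp: bounded_operators_def)

text \<open>
  The form with an explicit nonnegativity hypothesis applies directly to functionals on an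
  \<open>E\<close>-sum.
\<close>

lemma vnorm_le_operator_norm:
  assumes T: "T \<in> bounded_operators X Y"
    and nonneg: "\<And>x. x \<in> carrier X \<Longrightarrow> 0 \<le> vnorm X x"
    and x: "x \<in> carrier X" "vnorm X x \<le> 1"
  shows "vnorm Y (T x) \<le> operator_norm X Y T"
proof -
  obtain K where K: "\<And>x. x \<in> carrier X \<Longrightarrow> vnorm Y (T x) \<le> K * vnorm X x"
    using T unfolding bounded_operators_def by blast
  have "vnorm Y (T y) \<le> \<bar>K\<bar>" if "y \<in> carrier X" "vnorm X y \<le> 1" for y
  proof -
    have "vnorm Y (T y) \<le> K * vnorm X y"
      using K that by blast
    also have "\<dots> \<le> \<bar>K\<bar> * vnorm X y"
      using nonneg that by (intro mult_right_mono) auto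
    also have "\<dots> \<le> \<bar>K\<bar>"
      using that by (intro mult_left_le) auto
    finally show ?thesis .
  qed
  then have "bdd_above ((\<lambda>y. vnorm Y (T y)) ` {y \<in> carrier X. vnorm X y \<le> 1})"
    by (intro bdd_aboveI[of _ "\<bar>K\<bar>"]) auto
  then show ?thesis
    unfolding operator_norm_def using x by (intro cSUP_upper) auto
qed

lemma dual_norm_eq_1I:
  assumes "\<And>y. y \<in> carrier X \<Longrightarrow> vnorm X y \<le> 1 \<Longrightarrow> norm (g y) \<le> 1"
    and "u \<in> carrier X" "vnorm X u \<le> 1" "g u = 1"
  shows "dual_norm X g = 1"
  unfolding operator_norm_def
proof (rule cSup_eq_maximum)
  show "1 \<in> (\<lambda>x. vnorm scalar_space (g x)) ` {x \<in> carrier X. vnorm X x \<le> 1}"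
    using assms(2-4) by (intro image_eqI[of _ _ u]) auto
qed (use assms(1) in auto)

section \<open>Sign-invariant function norms\<close>

locale absolute_function_norm =
  fixes E :: "('i \<Rightarrow> real) set" and N :: "('i \<Rightarrow> real) \<Rightarrow> real"
  assumes add_closed: "a \<in> E \<Longrightarrow> b \<in> E \<Longrightarrow> (\<lambda>i. a i + b i) \<in> E"
    and scale_closed: "a \<in> E \<Longrightarrow> (\<lambda>i. c * a i) \<in> E"
    and triangle: "a \<in> E \<Longrightarrow> b \<in> E \<Longrightarrow> N (\<lambda>i. a i + b i) \<le> N a + N b"
    and scale: "a \<in> E \<Longrightarrow> N (\<lambda>i. c * a i) = \<bar>c\<bar> * N a"
    and absolute: "a \<in> E \<Longrightarrow> (\<And>i. \<bar>a i\<bar> = \<bar>b i\<bar>) \<Longrightarrow> b \<in> E \<and> N b = N a"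
    and unit: "indicator {i} \<in> E" "N (indicator {i}) = 1"
begin

lemma nonneg:
  assumes "a \<in> E"
  shows "0 \<le> N a"
proof -
  have "N (\<lambda>i. a i + (- 1) * a i) \<le> N a + N (\<lambda>i. (- 1) * a i)"
    using assms by (intro triangle scale_closed)
  moreover have "N (\<lambda>i. a i + (- 1) * a i) = 0"
    using scale[OF assms, of 0] by simp
  ultimately show ?thesis
    using scale[OF assms, of "-1"] by simp
qed

lemma scaled_unit: "(\<lambda>i. if i = l then t else 0) \<in> E \<and> N (\<lambda>i. if i = l then t else 0) = \<bar>t\<bar>"
proof -
  have "(\<lambda>i. if i = l then t else 0) = (\<lambda>i. t * indicator {l} i)"
    by (auto simp: fun_eq_iff indicator_def)
  then show ?thesis
    using scale_closed[OF unit(1), of t l] scale[OF unit(1), of t l] by (simp add: unit(2))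
qed

text \<open>
  Both forms of monotonicity come from convexity: the average of two functions of equal
  modulus has at most their common norm.
\<close>

lemma convex_combination:
  assumes a: "a \<in> E" and b: "\<And>i. \<bar>a i\<bar> = \<bar>b i\<bar>" and t: "0 \<le> t" "t \<le> 1"
  shows "(\<lambda>i. t * a i + (1 - t) * b i) \<in> E \<and> N (\<lambda>i. t * a i + (1 - t) * b i) \<le> N a"
proof -
  have bE: "b \<in> E" "N b = N a"
    using absolute[OF a b] by auto
  have "N (\<lambda>i. t * a i + (1 - t) * b i) \<le> N (\<lambda>i. t * a i) + N (\<lambda>i. (1 - t) * b i)"
    using a bE by (intro triangle scale_closed)
  also have "\<dots> = N a"
    using a bE t by (simp add: scale) (simp add: algebra_simps)
  finally show ?thesis
    using add_closed[OF scale_closed[OF a] scale_closed[OF bE(1)]] by simp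
qed

lemma coordinate_le:
  assumes "a \<in> E"
  shows "\<bar>a l\<bar> \<le> N a"
proof -
  let ?b = "\<lambda>i. if i = l then a i else - a i"
  have "N (\<lambda>i. 1/2 * a i + (1 - 1/2) * ?b i) \<le> N a"
    using convex_combination[of a ?b "1/2"] assms by simp
  moreover have "(\<lambda>i. 1/2 * a i + (1 - 1/2) * ?b i) = (\<lambda>i. if i = l then a l else 0)"
    by (auto simp: fun_eq_iff)
  ultimately show ?thesis
    using scaled_unit[of l "a l"] by simp
qed

lemma decrease_coordinate:
  assumes a: "a \<in> E" and s: "\<bar>s\<bar> \<le> \<bar>a l\<bar>"
  shows "a(l := s) \<in> E \<and> N (a(l := s)) \<le> N a"
proof (cases "a l = 0")
  case True
  then have "a(l := s) = a"
    using s by (auto simp: fun_eq_iff)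
  then show ?thesis
    using a by simp
next
  case False
  \<comment> \<open>The number \<open>s\<close> lies between \<open>a l\<close> and \<open>- a l\<close>, namely \<open>s = t * a l + (1 - t) * (- a l)\<close>.\<close>
  define t where "t = (1 + s / a l) / 2"
  have "\<bar>s / a l\<bar> \<le> 1"
    using s False by (simp add: abs_divide)
  then have "- 1 \<le> s / a l" "s / a l \<le> 1"
    by linarith+
  then have t: "0 \<le> t" "t \<le> 1"
    by (simp_all add: t_def)
  have "(\<lambda>i. t * a i + (1 - t) * (a(l := - a l)) i) = a(l := s)"
    using False by (auto simp: fun_eq_iff t_def field_simps)
  then show ?thesis
    using convex_combination[of a "a(l := - a l)" t] a t by simp
qed

end

section \<open>A summand inside an absolute sum\<close>

locale absolute_sum = absolute_function_norm E N
  for E :: "('i \<Rightarrow> real) set" and N +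
  fixes X :: "'i \<Rightarrow> ('k::{real_normed_field, euclidean_space}, 'a) normed_module"
  assumes summand: "normed_space (X i)"
begin

abbreviation Z :: "('k, 'i \<Rightarrow> 'a) normed_module" where
  "Z \<equiv> E_sum E N X"

definition embed :: "'i \<Rightarrow> 'a \<Rightarrow> 'i \<Rightarrow> 'a" where
  "embed l y = (\<lambda>i. \<zero>\<^bsub>X i\<^esub>)(l := y)"

lemma embed_same [simp]: "embed l y l = y"
  by (simp add: embed_def)

sublocale normed_space "X i" for i
  by (rule summand)

lemma carrier_Z: "x \<in> carrier Z \<longleftrightarrow> (\<forall>i. x i \<in> carrier (X i)) \<and> (\<lambda>i. vnorm (X i) (x i)) \<in> E"
  by (simp add: E_sum_def)

lemma Z_simps:
  "vnorm Z x = N (\<lambda>i. vnorm (X i) (x i))"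
  "x \<oplus>\<^bsub>Z\<^esub> y = (\<lambda>i. x i \<oplus>\<^bsub>X i\<^esub> y i)"
  "c \<odot>\<^bsub>Z\<^esub> x = (\<lambda>i. c \<odot>\<^bsub>X i\<^esub> x i)"
  by (simp_all add: E_sum_def)

lemma vnorm_Z_nonneg: "x \<in> carrier Z \<Longrightarrow> 0 \<le> vnorm Z x"
  by (simp add: carrier_Z Z_simps nonneg)

lemma vnorm_coordinate_le:
  assumes "x \<in> carrier Z"
  shows "vnorm (X l) (x l) \<le> vnorm Z x"
  using assms coordinate_le[of "\<lambda>i. vnorm (X i) (x i)" l] by (simp add: carrier_Z Z_simps)

lemma embed_isometric:
  assumes "y \<in> carrier (X l)"
  shows "embed l y \<in> carrier Z" and "vnorm Z (embed l y) = vnorm (X l) y"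
proof -
  have "(\<lambda>i. vnorm (X i) (embed l y i)) = (\<lambda>i. if i = l then vnorm (X l) y else 0)"
    by (auto simp: embed_def fun_eq_iff)
  then show "embed l y \<in> carrier Z" "vnorm Z (embed l y) = vnorm (X l) y"
    using scaled_unit[of l "vnorm (X l) y"] assms
    by (auto simp: carrier_Z Z_simps vnorm_nonneg embed_def)
qed

lemma embed_add:
  assumes "y \<in> carrier (X l)" "z \<in> carrier (X l)"
  shows "embed l (y \<oplus>\<^bsub>X l\<^esub> z) = embed l y \<oplus>\<^bsub>Z\<^esub> embed l z"
  using assms by (auto simp: embed_def Z_simps fun_eq_iff)

lemma embed_smult: "embed l (c \<odot>\<^bsub>X l\<^esub> y) = c \<odot>\<^bsub>Z\<^esub> embed l y"
  by (auto simp: embed_def Z_simps fun_eq_iff)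

lemma vnorm_replace_coordinate_le:
  assumes x: "x \<in> carrier Z" and y: "y \<in> carrier (X l)" "vnorm (X l) y \<le> vnorm (X l) (x l)"
  shows "x(l := y) \<in> carrier Z" and "vnorm Z (x(l := y)) \<le> vnorm Z x"
proof -
  let ?a = "\<lambda>i. vnorm (X i) (x i)"
  have "(\<lambda>i. vnorm (X i) ((x(l := y)) i)) = ?a(l := vnorm (X l) y)"
    by (auto simp: fun_eq_iff)
  then show "x(l := y) \<in> carrier Z" "vnorm Z (x(l := y)) \<le> vnorm Z x"
    using decrease_coordinate[of ?a "vnorm (X l) y" l] x y
    by (auto simp: carrier_Z Z_simps vnorm_nonneg)
qed

section \<open>Lifting operators from a summand\<close>

definition lift_operator :: "'i \<Rightarrow> ('a \<Rightarrow> 'a) \<Rightarrow> ('i \<Rightarrow> 'a) \<Rightarrow> 'i \<Rightarrow> 'a" where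
  "lift_operator l T x = embed l (T (x l))"

lemma lift_operator_bounded:
  assumes T: "T \<in> bounded_operators (X l) (X l)"
  shows "lift_operator l T \<in> bounded_operators Z Z"
proof -
  note T_simps = bounded_operatorsD[OF T]
  obtain K where K: "\<And>y. y \<in> carrier (X l) \<Longrightarrow> vnorm (X l) (T y) \<le> K * vnorm (X l) y"
    using T unfolding bounded_operators_def by blast
  have "vnorm Z (lift_operator l T x) \<le> \<bar>K\<bar> * vnorm Z x" if x: "x \<in> carrier Z" for x
  proof -
    have xl: "x l \<in> carrier (X l)"
      using x by (simp add: carrier_Z)
    have "vnorm Z (lift_operator l T x) = vnorm (X l) (T (x l))"
      by (simp add: lift_operator_def embed_isometric T_simps xl)
    also have "\<dots> \<le> \<bar>K\<bar> * vnorm (X l) (x l)"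
      using K[OF xl] mult_right_mono[OF abs_ge_self[of K] vnorm_nonneg[OF xl]] by linarith
    also have "\<dots> \<le> \<bar>K\<bar> * vnorm Z x"
      using vnorm_coordinate_le[OF x] by (intro mult_left_mono) auto
    finally show ?thesis .
  qed
  moreover have "lift_operator l T (x \<oplus>\<^bsub>Z\<^esub> y) = lift_operator l T x \<oplus>\<^bsub>Z\<^esub> lift_operator l T y"
    if "x \<in> carrier Z" "y \<in> carrier Z" for x y
  proof -
    have "x l \<in> carrier (X l)" "y l \<in> carrier (X l)"
      using that by (simp_all add: carrier_Z)
    then show ?thesis
      by (simp add: lift_operator_def embed_add[symmetric] T_simps) (simp add: Z_simps T_simps)
  qed
  moreover have "lift_operator l T (c \<odot>\<^bsub>Z\<^esub> x) = c \<odot>\<^bsub>Z\<^esub> lift_operator l T x"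
    if "x \<in> carrier Z" for c x
  proof -
    have "x l \<in> carrier (X l)"
      using that by (simp add: carrier_Z)
    then show ?thesis
      by (simp add: lift_operator_def embed_smult[symmetric]) (simp add: Z_simps T_simps)
  qed
  moreover have "lift_operator l T x \<in> carrier Z" if "x \<in> carrier Z" for x
    using that by (simp add: lift_operator_def embed_isometric T_simps carrier_Z[of x])
  ultimately show ?thesis
    unfolding bounded_operators_def by blast
qed

text \<open>
  The coordinate projection maps the unit ball of the sum onto the unit ball of the summand, so
  the two suprema range over the same set of numbers.
\<close>

lemma operator_norm_lift_operator:
  assumes T: "T \<in> bounded_operators (X l) (X l)"
  shows "operator_norm Z Z (lift_operator l T) = operator_norm (X l) (X l) T"
proof -
  let ?B = "{x \<in> carrier Z. vnorm Z x \<le> 1}" and ?Bl = "{y \<in> carrier (X l). vnorm (X l) y \<le> 1}"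
  have lift: "vnorm Z (lift_operator l T x) = vnorm (X l) (T (x l))" if "x \<in> carrier Z" for x
    using that bounded_operatorsD(1)[OF T]
    by (simp add: lift_operator_def embed_isometric carrier_Z)
  have ball: "(\<lambda>x. x l) ` ?B = ?Bl"
  proof (intro equalityI subsetI)
    fix y assume "y \<in> (\<lambda>x. x l) ` ?B"
    then obtain x where x: "x \<in> carrier Z" "vnorm Z x \<le> 1" and y: "y = x l"
      by blast
    then show "y \<in> ?Bl"
      using vnorm_coordinate_le[OF x(1), of l] by (simp add: carrier_Z)
  next
    fix y assume "y \<in> ?Bl"
    then show "y \<in> (\<lambda>x. x l) ` ?B"
      using embed_isometric[of y l] by (intro image_eqI[of _ _ "embed l y"]) simp_all
  qed
  have "(\<lambda>y. vnorm (X l) (T y)) ` ?Bl = (\<lambda>x. vnorm (X l) (T (x l))) ` ?B"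
    by (simp only: ball[symmetric] image_image)
  also have "\<dots> = (\<lambda>x. vnorm Z (lift_operator l T x)) ` ?B"
    by (intro image_cong) (auto simp: lift)
  finally show ?thesis
    by (simp add: operator_norm_def)
qed

section \<open>Norming pairs of the sum and of a summand\<close>

text \<open>
  Rotate \<open>y\<close> by a scalar \<open>c\<close> of modulus one so that \<open>f\<close> becomes nonnegative at \<open>embed l y\<close>.
  Exchanging \<open>x l\<close> for \<open>c y\<close> leaves \<open>x\<close> in the unit ball, where the real part of \<open>f\<close> is at most
  \<open>1 = f x\<close>; so the exchange cannot increase the real part of the contribution of the coordinate
  \<open>l\<close>.  In the scalar field, viewed as a Euclidean space, the real part of \<open>z\<close> is \<open>z \<bullet> 1\<close>.
\<close>

lemma norming_functional_attains_on_coordinate: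
  assumes xf: "(x, f) \<in> norming_pairs Z"
    and y: "y \<in> carrier (X l)" "vnorm (X l) y \<le> vnorm (X l) (x l)"
  shows "norm (f (embed l y)) \<le> norm (f (embed l (x l)))"
proof -
  have x: "x \<in> carrier Z" "vnorm Z x = 1" and f: "f \<in> dual Z" "dual_norm Z f = 1" "f x = 1"
    using xf by (auto simp: norming_pairs_def)
  have xl: "x l \<in> carrier (X l)"
    using x by (simp add: carrier_Z)
  obtain c where c: "norm c = 1" "c * f (embed l y) = of_real (norm (f (embed l y)))"
  proof (cases "f (embed l y) = 0")
    case True
    then show thesis using that[of 1] by simp
  next
    case False
    then show thesis
      using that[of "of_real (norm (f (embed l y))) / f (embed l y)"] by (simp add: norm_divide)
  qed
  define y' where "y' = c \<odot>\<^bsub>X l\<^esub> y"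
  have y': "y' \<in> carrier (X l)" "vnorm (X l) y' \<le> vnorm (X l) (x l)"
    using y c by (simp_all add: y'_def vnorm_smult)
  note w = vnorm_replace_coordinate_le[OF x(1) y']
  have "x(l := y') \<oplus>\<^bsub>Z\<^esub> embed l (x l) = x \<oplus>\<^bsub>Z\<^esub> embed l y'"
    using x(1) xl y'(1) by (auto simp: Z_simps embed_def fun_eq_iff carrier_Z a_comm)
  then have "f (x(l := y') \<oplus>\<^bsub>Z\<^esub> embed l (x l)) = f (x \<oplus>\<^bsub>Z\<^esub> embed l y')"
    by (rule arg_cong)
  then have "f (x(l := y')) + f (embed l (x l)) = 1 + f (embed l y')"
    by (simp only: bounded_operatorsD(2)[OF f(1)] w(1) x(1) embed_isometric(1)[OF xl]
        embed_isometric(1)[OF y'(1)] f(3) scalar_space_simps(5))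
  moreover have "f (embed l y') = of_real (norm (f (embed l y)))"
    using bounded_operatorsD(3)[OF f(1), of "embed l y" c] embed_isometric(1)[OF y(1)] c(2)
    by (simp add: y'_def embed_smult)
  ultimately have "(f (x(l := y')) + f (embed l (x l))) \<bullet> 1
      = (1 + of_real (norm (f (embed l y)))) \<bullet> (1 :: 'k)"
    by (simp only:)
  then have "f (x(l := y')) \<bullet> 1 + f (embed l (x l)) \<bullet> 1 = 1 + norm (f (embed l y))"
    by (simp add: inner_add_left of_real_def dot_square_norm)
  moreover have "f (x(l := y')) \<bullet> 1 \<le> 1"
  proof -
    have "norm (f (x(l := y'))) \<le> 1"
      using vnorm_le_operator_norm[OF f(1) vnorm_Z_nonneg w(1)] w(2) x(2) f(2) by simp
    then show ?thesis
      using norm_cauchy_schwarz[of "f (x(l := y'))" 1] by simp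
  qed
  moreover have "f (embed l (x l)) \<bullet> 1 \<le> norm (f (embed l (x l)))"
    using norm_cauchy_schwarz[of "f (embed l (x l))" 1] by simp
  ultimately show ?thesis
    by linarith
qed

text \<open>
  The pair is \<open>u = x l / \<parallel>x l\<parallel>\<close> and \<open>g = f\<^sub>l / f\<^sub>l u\<close>; it exists as soon as \<open>T\<close> contributes
  anything to the numerical radius of the lifted operator at \<open>(x, f)\<close>.
\<close>

lemma norming_pair_of_summand:
  assumes xf: "(x, f) \<in> norming_pairs Z"
    and T: "T \<in> bounded_operators (X l) (X l)"
    and nonzero: "f (lift_operator l T x) \<noteq> 0"
  obtains u g where "(u, g) \<in> norming_pairs (X l)"
    and "norm (f (lift_operator l T x)) \<le> norm (g (T u))"
proof -
  have x: "x \<in> carrier Z" "vnorm Z x = 1" and f: "f \<in> dual Z" "dual_norm Z f = 1" "f x = 1"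
    using xf by (auto simp: norming_pairs_def)
  have xl: "x l \<in> carrier (X l)"
    using x by (simp add: carrier_Z)
  define h where "h y = f (embed l y)" for y
  define r where "r = vnorm (X l) (x l)"
  have h_add: "h (y \<oplus>\<^bsub>X l\<^esub> z) = h y + h z"
    if "y \<in> carrier (X l)" "z \<in> carrier (X l)" for y z
    using that bounded_operatorsD(2)[OF f(1)] by (simp add: h_def embed_add embed_isometric)
  have h_smult: "h (c \<odot>\<^bsub>X l\<^esub> y) = c * h y" if "y \<in> carrier (X l)" for c y
    using that bounded_operatorsD(3)[OF f(1)] by (simp add: h_def embed_smult embed_isometric)
  have T_simps: "T (x l) \<in> carrier (X l)" "T (c \<odot>\<^bsub>X l\<^esub> x l) = c \<odot>\<^bsub>X l\<^esub> T (x l)" for c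
    using bounded_operatorsD[OF T] xl by auto
  have hT: "h (T (x l)) \<noteq> 0"
    using nonzero by (simp add: h_def lift_operator_def)
  have "x l \<noteq> \<zero>\<^bsub>X l\<^esub>"
  proof
    assume "x l = \<zero>\<^bsub>X l\<^esub>"
    then have "h (T (x l)) = 0"
      using T_simps(2)[of 0] h_smult[OF T_simps(1), of 0] xl by simp
    with hT show False ..
  qed
  then have r: "r > 0"
    using vnorm_nonneg[OF xl] vnorm_eq_zero[OF xl] by (simp add: r_def less_le)
  define u where "u = of_real (1 / r) \<odot>\<^bsub>X l\<^esub> x l"
  have u: "u \<in> carrier (X l)" "vnorm (X l) u = 1"
    using xl r by (simp_all add: u_def vnorm_smult r_def[symmetric] norm_divide)
  have hu: "h u = of_real (1 / r) * h (x l)"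
    using h_smult[OF xl] by (simp add: u_def)
  have h_ball: "norm (h y) \<le> norm (h u)" if y: "y \<in> carrier (X l)" "vnorm (X l) y \<le> 1" for y
  proof -
    have "norm (h (of_real r \<odot>\<^bsub>X l\<^esub> y)) \<le> norm (h (x l))"
      unfolding h_def using y r
      by (intro norming_functional_attains_on_coordinate[OF xf])
         (auto simp: vnorm_smult r_def[symmetric] mult_left_le)
    then show ?thesis
      using r y by (simp add: h_smult hu norm_mult norm_divide field_simps)
  qed
  have h_bound: "norm (h y) \<le> norm (h u) * vnorm (X l) y" if y: "y \<in> carrier (X l)" for y
  proof (cases "y = \<zero>\<^bsub>X l\<^esub>")
    case True
    then show ?thesis
      using h_smult[OF y, of 0] y by simp
  next
    case False
    define s where "s = vnorm (X l) y"
    have s: "s > 0"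
      using vnorm_nonneg[OF y] vnorm_eq_zero[OF y] False by (simp add: s_def less_le)
    have "norm (h (of_real (1 / s) \<odot>\<^bsub>X l\<^esub> y)) \<le> norm (h u)"
      using y s by (intro h_ball) (auto simp: vnorm_smult s_def[symmetric] norm_divide)
    then show ?thesis
      using y s by (simp add: h_smult norm_mult norm_divide s_def[symmetric] field_simps)
  qed
  have hu_nonzero: "h u \<noteq> 0"
    using h_bound[OF T_simps(1)] hT by auto
  define g where "g y = h y / h u" for y
  have "g \<in> dual (X l)"
  proof -
    have "norm (g y) \<le> 1 * vnorm (X l) y" if "y \<in> carrier (X l)" for y
      using h_bound[OF that] hu_nonzero by (simp add: g_def norm_divide field_simps)
    then show ?thesis
      unfolding bounded_operators_def
      by (auto simp: g_def h_add h_smult add_divide_distrib simp del: mult_1 intro!: exI[of _ 1])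
  qed
  moreover have "g u = 1"
    using hu_nonzero by (simp add: g_def)
  moreover have "dual_norm (X l) g = 1"
    using h_ball u hu_nonzero
    by (intro dual_norm_eq_1I[where u = u]) (auto simp: g_def norm_divide)
  ultimately have "(u, g) \<in> norming_pairs (X l)"
    using u by (simp add: norming_pairs_def)
  moreover have "norm (f (lift_operator l T x)) \<le> norm (g (T u))"
  proof -
    have "T u = of_real (1 / r) \<odot>\<^bsub>X l\<^esub> T (x l)"
      by (simp add: u_def T_simps)
    then have "g (T u) = h (T (x l)) / h (x l)"
      using r by (simp add: g_def h_smult T_simps hu)
    moreover have "norm (h (x l)) \<le> 1"
      unfolding h_def
      using vnorm_le_operator_norm[OF f(1) vnorm_Z_nonneg embed_isometric(1)[OF xl]]
        vnorm_coordinate_le[OF x(1), of l] x(2) f(2) by (simp add: embed_isometric[OF xl])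
    moreover have "h (x l) \<noteq> 0"
      using hu_nonzero hu by auto
    ultimately show ?thesis
      by (simp add: norm_divide lift_operator_def h_def[symmetric] pos_le_divide_eq mult_left_le)
  qed
  ultimately show thesis
    by (rule that)
qed

lemma numerical_radius_lift_operator_le:
  assumes T: "T \<in> bounded_operators (X l) (X l)"
  shows "numerical_radius Z (lift_operator l T) \<le> numerical_radius (X l) T"
  unfolding numerical_radius_def[of Z]
proof (intro SUP_least, clarify)
  fix x f assume xf: "(x, f) \<in> norming_pairs Z"
  show "ennreal (norm (f (lift_operator l T x))) \<le> numerical_radius (X l) T"
  proof (cases "f (lift_operator l T x) = 0")
    case True
    then show ?thesis by simp
  next
    case False
    obtain u g where "(u, g) \<in> norming_pairs (X l)"
      and le: "norm (f (lift_operator l T x)) \<le> norm (g (T u))"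
      using norming_pair_of_summand[OF xf T False] .
    then have "ennreal (norm (g (T u))) \<le> numerical_radius (X l) T"
      unfolding numerical_radius_def by (intro SUP_upper2[of "(u, g)"]) auto
    then show ?thesis
      using ennreal_leI[OF le] by (rule order_trans[rotated])
  qed
qed

lemma numerical_index_E_sum_le: "numerical_index Z \<le> numerical_index (X l)"
  unfolding numerical_index_def[of "X l"]
proof (rule INF_greatest)
  fix T assume "T \<in> {T \<in> bounded_operators (X l) (X l). operator_norm (X l) (X l) T = 1}"
  then have T: "T \<in> bounded_operators (X l) (X l)" "operator_norm (X l) (X l) T = 1"
    by auto
  then have "numerical_index Z \<le> numerical_radius Z (lift_operator l T)"
    unfolding numerical_index_def
    by (intro INF_lower) (auto simp: lift_operator_bounded operator_norm_lift_operator)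
  also have "\<dots> \<le> numerical_radius (X l) T"
    by (rule numerical_radius_lift_operator_le[OF T(1)])
  finally show "numerical_index Z \<le> numerical_radius (X l) T" .
qed

end

section \<open>Absolute norms and one-unconditional bases\<close>

lemma absolute_norm_imp_absolute_function_norm:
  assumes "absolute_norm E N"
  shows "absolute_function_norm E N"
proof -
  note parts = assms[unfolded absolute_norm_def]
  note abs = parts[THEN conjunct2, THEN conjunct1, rule_format]
    and unit = parts[THEN conjunct2, THEN conjunct2, rule_format]
  interpret F: normed_space "function_space E N"
    by (rule banach_space.axioms[OF parts[THEN conjunct1]])
  have F_simps: "carrier (function_space E N) = E" "vnorm (function_space E N) = N"
    "a \<oplus>\<^bsub>function_space E N\<^esub> b = (\<lambda>i. a i + b i)"
    "c \<odot>\<^bsub>function_space E N\<^esub> a = (\<lambda>i. c * a i)" for a b c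
    by (simp_all add: function_space_def)
  show ?thesis
  proof
    fix a b assume "a \<in> E" "b \<in> E"
    then show "(\<lambda>i. a i + b i) \<in> E" "N (\<lambda>i. a i + b i) \<le> N a + N b"
      using F.add.m_closed[of a b] F.vnorm_triangle[of a b] by (simp_all add: F_simps)
  next
    fix a c assume "a \<in> E"
    then show "(\<lambda>i. c * a i) \<in> E" "N (\<lambda>i. c * a i) = \<bar>c\<bar> * N a"
      using F.smult_closed'[of a c] F.vnorm_smult[of a c] by (simp_all add: F_simps)
  next
    fix a b assume "a \<in> E" "\<And>i. \<bar>a i\<bar> = \<bar>b i\<bar>"
    then show "b \<in> E \<and> N b = N a"
      using abs[of a b] by simp
  qed (simp_all add: unit)
qed

lemma one_unconditional_basis_imp_absolute_function_norm:
  fixes e :: "nat \<Rightarrow> 'e::banach"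
  assumes e: "one_unconditional_basis e" and normalized: "\<And>n. norm (e n) = 1"
  shows "absolute_function_norm (coefficients e) (coefficient_norm e)"
proof
  fix a b assume a: "a \<in> coefficients e" and ab: "\<And>i. \<bar>a i\<bar> = \<bar>b i\<bar>"
  define \<theta> :: "nat \<Rightarrow> real" where "\<theta> i = (if a i = b i then 1 else - 1)" for i
  have "\<theta> n * a n = b n" for n
    using ab[of n] by (auto simp: \<theta>_def abs_eq_iff)
  moreover have "summable (\<lambda>n. (\<theta> n * a n) *\<^sub>R e n) \<and>
      norm (\<Sum>n. (\<theta> n * a n) *\<^sub>R e n) = norm (\<Sum>n. a n *\<^sub>R e n)"
    using e a unfolding one_unconditional_basis_def coefficients_def by (simp add: \<theta>_def)
  ultimately show "b \<in> coefficients e \<and> coefficient_norm e b = coefficient_norm e a"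
    by (simp add: coefficients_def coefficient_norm_def)
next
  fix a b assume "a \<in> coefficients e" "b \<in> coefficients e"
  then show "(\<lambda>i. a i + b i) \<in> coefficients e"
    and "coefficient_norm e (\<lambda>i. a i + b i) \<le> coefficient_norm e a + coefficient_norm e b"
    by (simp_all add: coefficients_def coefficient_norm_def scaleR_add_left summable_add
        suminf_add[symmetric] norm_triangle_ineq)
next
  fix a c assume "a \<in> coefficients e"
  then show "(\<lambda>i. c * a i) \<in> coefficients e"
    and "coefficient_norm e (\<lambda>i. c * a i) = \<bar>c\<bar> * coefficient_norm e a"
    by (simp_all add: coefficients_def coefficient_norm_def scaleR_scaleR[symmetric]
        summable_scaleR_right suminf_scaleR_right[symmetric] del: scaleR_scaleR)
next
  fix i
  have "(\<lambda>n. indicator {i} n *\<^sub>R e n) = (\<lambda>n. if n = i then e n else 0)"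
    by (auto simp: fun_eq_iff indicator_def)
  then have "(\<lambda>n. indicator {i} n *\<^sub>R e n) sums e i"
    using sums_single[of i e] by simp
  then show "indicator {i} \<in> coefficients e" "coefficient_norm e (indicator {i}) = 1"
    using normalized
    by (auto simp: coefficients_def coefficient_norm_def sums_iff)
qed

theorem corollary2p4:
  fixes N :: "('i::finite \<Rightarrow> real) \<Rightarrow> real"
    and X :: "'i \<Rightarrow> ('k::{real_normed_field, euclidean_space}, 'a) normed_module"
    and e :: "nat \<Rightarrow> 'e::banach"
    and Y :: "nat \<Rightarrow> ('k, 'a) normed_module"
  shows "(absolute_norm UNIV N \<and>
          (\<forall>i. banach_space (X i) \<and> carrier (X i) \<noteq> {\<zero>\<^bsub>X i\<^esub>}) \<longrightarrow>
            numerical_index (E_sum UNIV N X) \<le> Min (range (\<lambda>i. numerical_index (X i))))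
       \<and> (one_unconditional_basis e \<and> (\<forall>n. norm (e n) = 1) \<and>
          (\<forall>j. banach_space (Y j) \<and> carrier (Y j) \<noteq> {\<zero>\<^bsub>Y j\<^esub>}) \<longrightarrow>
            numerical_index (E_sum (coefficients e) (coefficient_norm e) Y)
              \<le> (INF j. numerical_index (Y j)))"
proof (intro conjI impI)
  assume "absolute_norm UNIV N \<and>
    (\<forall>i. banach_space (X i) \<and> carrier (X i) \<noteq> {\<zero>\<^bsub>X i\<^esub>})"
  then interpret absolute_sum UNIV N X
    by (intro absolute_sum.intro absolute_norm_imp_absolute_function_norm absolute_sum_axioms.intro)
       (auto intro: banach_space.axioms)
  show "numerical_index (E_sum UNIV N X) \<le> Min (range (\<lambda>i. numerical_index (X i)))"
    using numerical_index_E_sum_le by (intro Min.boundedI) auto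
next
  assume "one_unconditional_basis e \<and> (\<forall>n. norm (e n) = 1) \<and>
    (\<forall>j. banach_space (Y j) \<and> carrier (Y j) \<noteq> {\<zero>\<^bsub>Y j\<^esub>})"
  then interpret absolute_sum "coefficients e" "coefficient_norm e" Y
    by (intro absolute_sum.intro one_unconditional_basis_imp_absolute_function_norm
        absolute_sum_axioms.intro) (auto intro: banach_space.axioms)
  show "numerical_index (E_sum (coefficients e) (coefficient_norm e) Y)
      \<le> (INF j. numerical_index (Y j))"
    by (intro INF_greatest numerical_index_E_sum_le)
qed

end
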